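(* Let $m\in(0,|B_1|)$ and $\delta\in(0,\inf\{2m,2(|B_1|-m)\})$. Let $E\subset B_1$ be a measurable set such that $|E|=m$ and $|E\Delta B_*|=\delta$, where $B_*$ is the centered ball of volume $m$. Then $$\int_{B_1}u_E\,dx\le\int_{B_1}u_{A_\delta}\,dx.$$
   Context: $B_1$ is the open unit ball of $\mathbb{R}^n$ ($n\ge1$) centered at the origin, $B_r$ is the open ball of radius $r$ centered at the origin, $|\cdot|$ on sets denotes Lebesgue measure, and $\Delta$ between sets is the symmetric difference. For a measurable set $E\subset B_1$, $u_E\in H^1_0(B_1)$ is the unique weak solution of $-\Delta u_E=\chi_E$ in $B_1$, $u_E=0$ on $\partial B_1$. Let $r_*$ be the radius of the centered ball $B_*$ with $|B_*|=m$. The set $A_\delta$ is $$A_\delta=B_{r_1(\delta)}\cup\{x\in\mathbb{R}^n: r_*<|x|<r_2(\delta)\},\quad r_1(\delta)=\frac{(m-\delta/2)^{1/n}}{|B_1|^{1/n}},\quad r_2(\delta)=\frac{(m+\delta/2)^{1/n}}{|B_1|^{1/n}},$$ so that $|A_\delta|=m$ and $|A_\delta\Delta B_*|=\delta$. *)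

theory Defs
  imports "HOL-Analysis.Analysis"
begin

primrec Ck :: "nat \<Rightarrow> ('a::euclidean_space \<Rightarrow> real) \<Rightarrow> bool" where
  "Ck 0 f \<longleftrightarrow> continuous_on UNIV f"
| "Ck (Suc k) f \<longleftrightarrow>
     (\<forall>x. f differentiable (at x)) \<and>
     (\<forall>b\<in>Basis. Ck k (\<lambda>x. frechet_derivative f (at x) b))"

text \<open>The space of smooth functions with compact support in the open set \<open>S\<close>;
  its members are extended by zero to the whole space.\<close>

definition test_function :: "'a::euclidean_space set \<Rightarrow> ('a \<Rightarrow> real) \<Rightarrow> bool" where
  "test_function S \<phi> \<longleftrightarrow>
     (\<forall>k. Ck k \<phi>) \<and>
     compact (closure {x. \<phi> x \<noteq> 0}) \<and> closure {x. \<phi> x \<noteq> 0} \<subseteq> S"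

definition L2_on :: "'a::euclidean_space set \<Rightarrow> ('a \<Rightarrow> 'b::euclidean_space) \<Rightarrow> bool" where
  "L2_on S f \<longleftrightarrow>
     f \<in> borel_measurable (lebesgue_on S) \<and>
     integrable (lebesgue_on S) (\<lambda>x. (norm (f x))\<^sup>2)"

definition weak_gradient ::
  "'a::euclidean_space set \<Rightarrow> ('a \<Rightarrow> real) \<Rightarrow> ('a \<Rightarrow> 'a) \<Rightarrow> bool" where
  "weak_gradient S u g \<longleftrightarrow>
     (\<forall>\<phi> D\<phi>. test_function S \<phi> \<longrightarrow> (\<forall>x. GDERIV \<phi> x :> D\<phi> x) \<longrightarrow>
        (LINT x|lebesgue_on S. u x *\<^sub>R D\<phi> x) = - (LINT x|lebesgue_on S. \<phi> x *\<^sub>R g x))"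

text \<open>Elements of Lebesgue and Sobolev spaces are represented by functions, only their values
  almost everywhere in \<open>S\<close> being relevant. The predicates \<open>H1 S u g\<close> and \<open>H10 S u g\<close> say that
  \<open>u\<close> is in the Sobolev space on \<open>S\<close> and that \<open>g\<close> is (a representative of) its weak gradient,
  which is determined almost everywhere by \<open>u\<close>.\<close>

definition H1 ::
  "'a::euclidean_space set \<Rightarrow> ('a \<Rightarrow> real) \<Rightarrow> ('a \<Rightarrow> 'a) \<Rightarrow> bool" where
  "H1 S u g \<longleftrightarrow> L2_on S u \<and> L2_on S g \<and> weak_gradient S u g"

text \<open>Closure of the test functions in the Sobolev norm.\<close>

definition H10 ::
  "'a::euclidean_space set \<Rightarrow> ('a \<Rightarrow> real) \<Rightarrow> ('a \<Rightarrow> 'a) \<Rightarrow> bool" where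
  "H10 S u g \<longleftrightarrow> H1 S u g \<and>
     (\<exists>\<phi> D\<phi>. (\<forall>k::nat. test_function S (\<phi> k) \<and> (\<forall>x. GDERIV (\<phi> k) x :> D\<phi> k x)) \<and>
        (\<lambda>k. LINT x|lebesgue_on S. (\<phi> k x - u x)\<^sup>2 + (norm (D\<phi> k x - g x))\<^sup>2)
          \<longlonglongrightarrow> 0)"

text \<open>Weak solution of \<open>-\<Delta>u = f\<close> in \<open>S\<close> with \<open>u = 0\<close> on the boundary of \<open>S\<close>.\<close>

definition weak_Dirichlet_solution ::
  "'a::euclidean_space set \<Rightarrow> ('a \<Rightarrow> real) \<Rightarrow> ('a \<Rightarrow> real) \<Rightarrow> bool" where
  "weak_Dirichlet_solution S f u \<longleftrightarrow>
     (\<exists>g. H10 S u g \<and>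
        (\<forall>v h. H10 S v h \<longrightarrow>
           (LINT x|lebesgue_on S. g x \<bullet> h x) = (LINT x|lebesgue_on S. f x * v x)))"

definition inner_radius :: "'a::euclidean_space itself \<Rightarrow> real \<Rightarrow> real \<Rightarrow> real" where
  "inner_radius _ m \<delta> =
     (m - \<delta> / 2) powr (1 / DIM('a)) / measure lebesgue (ball (0::'a) 1) powr (1 / DIM('a))"

definition outer_radius :: "'a::euclidean_space itself \<Rightarrow> real \<Rightarrow> real \<Rightarrow> real" where
  "outer_radius _ m \<delta> =
     (m + \<delta> / 2) powr (1 / DIM('a)) / measure lebesgue (ball (0::'a) 1) powr (1 / DIM('a))"

text \<open>Here \<open>r\<close> is the radius of the centered ball of measure \<open>m\<close>.\<close>

definition A_set :: "real \<Rightarrow> real \<Rightarrow> real \<Rightarrow> 'a::euclidean_space set" where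
  "A_set m r \<delta> =
     ball 0 (inner_radius TYPE('a) m \<delta>) \<union>
     {x. r < norm x \<and> norm x < outer_radius TYPE('a) m \<delta>}"

end

theory Submission
  imports Defs
begin

text \<open>
  The integral of \<open>u\<^sub>E\<close> is a linear functional of the set \<open>E\<close> with an explicit density. Let
  \<open>w = (1 - |x|\<^sup>2) / (2n)\<close> be the torsion function of the unit ball, the solution of
  \<open>-\<Delta>w = 1\<close> with zero boundary values. Testing the equation of \<open>w\<close> with \<open>u\<^sub>E\<close> and that of
  \<open>u\<^sub>E\<close> with \<open>w\<close> gives \<open>\<integral> u\<^sub>E = \<integral> \<nabla>w \<cdot> \<nabla>u\<^sub>E = \<integral>\<^sub>E w\<close>
  (\<open>integral_weak_Dirichlet_solution\<close>). As \<open>w\<close> is radially decreasing, the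
  problem becomes one about placing mass: a set with \<open>|E| = m\<close> and \<open>|E \<Delta> B\<^sub>*| = \<delta>\<close>
  has measure \<open>m - \<delta> / 2\<close> inside \<open>B\<^sub>*\<close> and \<open>\<delta> / 2\<close> outside, and \<open>\<integral>\<^sub>E w\<close> is largest if
  the inner part is a centered ball and the outer part is an annulus that touches \<open>B\<^sub>*\<close>. These are the
  two pieces of \<open>A\<^sub>\<delta>\<close> (\<open>integral_torsion_le_A_set\<close>).

  The analytic work is in the duality. It needs \<open>w\<close> to be a limit of
  test functions in the Sobolev norm (\<open>H10_torsion\<close>), which is shown with an explicit family of smooth
  cutoffs, and it needs the equation of \<open>w\<close> tested with \<open>u\<^sub>E\<close>. Since \<open>\<nabla>w = - x / n\<close>, the latter is the
  identity \<open>\<integral> \<nabla>u \<cdot> x = - n \<integral> u\<close> for functions with zero boundary values (\<open>H10_divergence\<close>), obtained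
  for test functions by integration by parts and then by approximation. The integration by
  parts rests only on the translation invariance of Lebesgue measure.
\<close>

section \<open>Integration by parts against test functions\<close>

lemma integrable_continuous_compact_support:
  fixes f :: "'a::euclidean_space \<Rightarrow> real"
  assumes "continuous_on UNIV f" "compact K" "\<And>x. x \<notin> K \<Longrightarrow> f x = 0"
  shows "integrable lborel f"
proof -
  have "integrable lborel (\<lambda>x. indicator K x *\<^sub>R f x)"
    using assms by (intro borel_integrable_compact) (auto intro: continuous_on_subset)
  also have "(\<lambda>x. indicator K x *\<^sub>R f x) = f"
    using assms(3) by (auto simp: indicator_def fun_eq_iff)
  finally show ?thesis .
qed

lemma integral_translate_lborel:
  fixes f :: "'a::euclidean_space \<Rightarrow> real"
  assumes "f \<in> borel_measurable borel"
  shows "(LINT x|lborel. f (c + x)) = (LINT x|lborel. f x)"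
proof -
  have "(LINT x|lborel. f x) = (LINT x|distr lborel borel ((+) c). f x)"
    by (simp add: lborel_distr_plus)
  also have "\<dots> = (LINT x|lborel. f (c + x))"
    using assms by (subst integral_distr) auto
  finally show ?thesis by simp
qed

text \<open>The difference quotients of \<open>f\<close> in direction \<open>b\<close> have integral zero by translation invariance.
  The mean value theorem bounds them, for steps of length at most one, by a constant on a fixed ball,
  and dominated convergence carries the value zero to the limit.\<close>

lemma integral_directional_derivative_eq_0:
  fixes f :: "'a::euclidean_space \<Rightarrow> real"
  assumes D: "\<And>x. (f has_derivative f' x) (at x)"
    and cont: "continuous_on UNIV (\<lambda>x. f' x b)"
    and K: "compact K" "\<And>x. x \<notin> K \<Longrightarrow> f x = 0"
  shows "(LINT x|lborel. f' x b) = 0"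
proof -
  have fc: "continuous_on UNIV f"
    using has_derivative_continuous[OF D] by (simp add: continuous_on_eq_continuous_within)
  then have fm: "f \<in> borel_measurable borel"
    by (rule borel_measurable_continuous_onI)
  obtain R where R: "\<And>x. norm x > R \<Longrightarrow> f x = 0" 
    using compact_imp_bounded[OF K(1)] K(2) unfolding bounded_iff by (meson linorder_not_le)
  \<comment> \<open>Difference quotients with steps up to \<open>b\<close> vanish outside the ball of radius \<open>R'\<close>; the segments
    along which they are estimated inside it stay in \<open>C\<close>.\<close>
  define R' where "R' = R + norm b"
  define C where "C = cball (0::'a) (R' + norm b)"
  have "bounded ((\<lambda>x. f' x b) ` C)"
    using cont by (intro compact_imp_bounded compact_continuous_image)
      (auto simp: C_def intro: continuous_on_subset)
  then obtain M where M: "\<And>x. x \<in> C \<Longrightarrow> \<bar>f' x b\<bar> \<le> M"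
    by (auto simp: bounded_iff)
  define s where "s k x = (f (inverse (real (Suc k)) *\<^sub>R b + x) - f x) / inverse (real (Suc k))" for k x
  have line: "((\<lambda>t. f (t *\<^sub>R b + x)) has_real_derivative f' (t *\<^sub>R b + x) b) (at t)" for x t
  proof -
    have "((\<lambda>t. f (t *\<^sub>R b + x)) has_derivative (\<lambda>h. f' (t *\<^sub>R b + x) (h *\<^sub>R b))) (at t)"
      by (rule has_derivative_compose[OF _ D]) (auto intro!: derivative_eq_intros)
    moreover have "f' y (h *\<^sub>R b) = f' y b * h" for y h
      using linear_scale[OF has_derivative_linear[OF D]] by (simp add: mult.commute)
    ultimately show ?thesis by (simp add: has_field_derivative_def)
  qed
  have "(\<lambda>k. LINT x|lborel. s k x) \<longlonglongrightarrow> (LINT x|lborel. f' x b)"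
  proof (rule integral_dominated_convergence)
    show "(\<lambda>x. f' x b) \<in> borel_measurable lborel"
      using borel_measurable_continuous_onI[OF cont] by simp
    show "s k \<in> borel_measurable lborel" for k
      unfolding s_def using fm by measurable
    show "integrable lborel (\<lambda>x. indicator (cball 0 R') x *\<^sub>R M)"
      by (rule borel_integrable_compact) auto
    show "AE x in lborel. (\<lambda>k. s k x) \<longlonglongrightarrow> f' x b"
    proof (intro AE_I2)
      fix x
      have "((\<lambda>h. (f (h *\<^sub>R b + x) - f x) / h) \<longlongrightarrow> f' x b) (at 0)"
        using line[of x 0] by (simp add: DERIV_def)
      moreover have "filterlim (\<lambda>k. inverse (real (Suc k))) (at 0) sequentially"
        using LIMSEQ_inverse_real_of_nat by (auto simp: filterlim_at)
      ultimately show "(\<lambda>k. s k x) \<longlonglongrightarrow> f' x b"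
        unfolding s_def by (rule filterlim_compose)
    qed
    show "AE x in lborel. norm (s k x) \<le> indicator (cball 0 R') x *\<^sub>R M" for k
    proof (intro AE_I2)
      fix x
      define t where "t = inverse (real (Suc k))"
      have t: "0 < t" "t \<le> 1" by (auto simp: t_def inverse_le_1_iff)
      have tb: "norm (y *\<^sub>R b) \<le> norm b" if "0 \<le> y" "y \<le> t" for y
        using that t by (simp add: mult_left_le_one_le)
      show "norm (s k x) \<le> indicator (cball 0 R') x *\<^sub>R M"
      proof (cases "x \<in> cball 0 R'")
        case False
        then have "norm x > R + norm b" by (simp add: R'_def)
        then have "f x = 0" "f (t *\<^sub>R b + x) = 0"
          using tb[of t] t norm_diff_ineq[of x "t *\<^sub>R b"] norm_ge_zero[of b]
          unfolding add.commute[of x] by (intro R; linarith)+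
        then show ?thesis using False by (simp add: s_def t_def)
      next
        case True
        obtain z where z: "0 < z" "z < t" "f (t *\<^sub>R b + x) - f (0 *\<^sub>R b + x) = (t - 0) * f' (z *\<^sub>R b + x) b"
          using MVT2[OF t(1), of "\<lambda>t. f (t *\<^sub>R b + x)" "\<lambda>t. f' (t *\<^sub>R b + x) b"] line by blast
        have "z *\<^sub>R b + x \<in> C"
          using True tb[of z] z norm_triangle_ineq[of "z *\<^sub>R b" x] by (auto simp: C_def simp del: norm_scaleR)
        from M[OF this] show ?thesis
          using z(3) t True by (simp add: s_def abs_mult del: of_nat_Suc flip: t_def)
      qed
    qed
  qed
  moreover have "(LINT x|lborel. s k x) = 0" for k
  proof -
    let ?c = "inverse (real (Suc k)) *\<^sub>R b"
    have i: "integrable lborel f"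
      using fc K by (rule integrable_continuous_compact_support)
    have i2: "integrable lborel (\<lambda>x. f (?c + x))"
    proof (rule integrable_continuous_compact_support)
      show "continuous_on UNIV (\<lambda>x. f (?c + x))"
        by (intro continuous_on_compose2[OF fc] continuous_intros) auto
      show "compact ((+) (- ?c) ` K)"
        using compact_translation[OF K(1)] .
      show "f (?c + x) = 0" if "x \<notin> (+) (- ?c) ` K" for x
        by (rule K(2), rule notI, rule that[THEN notE], rule image_eqI[of _ _ "?c + x"]) auto
    qed
    show ?thesis
      unfolding s_def using integral_translate_lborel[OF fm, of ?c] i i2 by simp
  qed
  ultimately show ?thesis
    by (simp add: LIMSEQ_const_iff)
qed

text \<open>Test functions are required to be smooth through iterated Frechet derivatives, while the weak
  formulation speaks of an arbitrary function that satisfies \<^const>\<open>gderiv\<close>; uniqueness of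
  the derivative identifies the two.\<close>

lemma test_function_gradient_continuous:
  assumes "test_function S \<phi>" and D: "\<And>x. GDERIV \<phi> x :> D\<phi> x"
  shows "continuous_on UNIV D\<phi>"
proof -
  have "Ck (Suc 0) \<phi>" using assms(1) by (simp only: test_function_def)
  moreover have "frechet_derivative \<phi> (at x) = (\<lambda>h. h \<bullet> D\<phi> x)" for x
    using frechet_derivative_at[of \<phi> "\<lambda>h. h \<bullet> D\<phi> x" x] D by (simp add: gderiv_def)
  ultimately have "continuous_on UNIV (\<lambda>x. D\<phi> x \<bullet> b)" if "b \<in> Basis" for b
    using that by (simp add: inner_commute)
  then show ?thesis by (rule continuous_on_componentwise[THEN iffD2, rule_format])
qed

lemma test_function_continuous: "test_function S \<phi> \<Longrightarrow> continuous_on UNIV \<phi>"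
  unfolding test_function_def using Ck.simps(1) by blast

lemma test_function_gradient_zero:
  assumes "test_function S \<phi>" and D: "\<And>x. GDERIV \<phi> x :> D\<phi> x"
    and "x \<notin> closure {x. \<phi> x \<noteq> 0}"
  shows "D\<phi> x = 0"
proof -
  have "((\<lambda>_. 0) has_derivative (\<lambda>h. h \<bullet> D\<phi> x)) (at x)"
  proof (rule has_derivative_transform_within_open)
    show "(\<phi> has_derivative (\<lambda>h. h \<bullet> D\<phi> x)) (at x)"
      using D by (simp add: gderiv_def)
    show "open (- closure {x. \<phi> x \<noteq> 0})" "x \<in> - closure {x. \<phi> x \<noteq> 0}" using assms(3) by auto
    show "\<phi> y = 0" if "y \<in> - closure {x. \<phi> x \<noteq> 0}" for y
      using that closure_subset[of "{x. \<phi> x \<noteq> 0}"] by auto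
  qed
  from has_derivative_unique[OF this has_derivative_const]
  have "(\<lambda>h. h \<bullet> D\<phi> x) = (\<lambda>h. 0)" .
  then have "D\<phi> x \<bullet> D\<phi> x = 0" by (rule fun_cong)
  then show ?thesis by simp
qed

lemma lebesgue_on_continuous_compact_support:
  fixes f :: "'a::euclidean_space \<Rightarrow> real"
  assumes "continuous_on UNIV f" "compact K" "\<And>x. x \<notin> K \<Longrightarrow> f x = 0" "K \<subseteq> S" "S \<in> sets lebesgue"
  shows "integrable (lebesgue_on S) f"
    and "(LINT x|lebesgue_on S. f x) = (LINT x|lborel. f x)"
proof -
  have eq: "(\<lambda>x. indicator S x *\<^sub>R f x) = f" using assms(3,4) by (auto simp: indicator_def fun_eq_iff)
  have fm: "f \<in> borel_measurable lborel" 
    using borel_measurable_continuous_onI[OF assms(1)] by simp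
  have i: "integrable lborel f"
    using assms(1-3) by (rule integrable_continuous_compact_support)
  then show "integrable (lebesgue_on S) f"
    using assms(5) fm by (subst integrable_restrict_space, simp, unfold eq) (simp add: integrable_completion)
  show "(LINT x|lebesgue_on S. f x) = (LINT x|lborel. f x)"
    using assms(5) fm by (subst integral_restrict_space, simp, unfold eq) (simp add: integral_completion)
qed

text \<open>The product \<open>\<phi> \<psi>\<close> is differentiable with compact support in \<open>S\<close>, so each of its directional
  derivatives has integral zero.\<close>

lemma integral_by_parts_test_function:
  fixes \<psi> :: "'a::euclidean_space \<Rightarrow> real"
  assumes t: "test_function S \<phi>" and D: "\<And>x. GDERIV \<phi> x :> D\<phi> x"
    and D': "\<And>x. GDERIV \<psi> x :> D\<psi> x" and c: "continuous_on UNIV D\<psi>"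
    and S: "S \<in> sets lebesgue"
  shows "integrable (lebesgue_on S) (\<lambda>x. \<psi> x * (D\<phi> x \<bullet> b))"
    and "integrable (lebesgue_on S) (\<lambda>x. \<phi> x * (D\<psi> x \<bullet> b))"
    and "(LINT x|lebesgue_on S. \<psi> x * (D\<phi> x \<bullet> b)) = - (LINT x|lebesgue_on S. \<phi> x * (D\<psi> x \<bullet> b))"
proof -
  define K where "K = closure {x. \<phi> x \<noteq> 0}"
  have K: "compact K" "K \<subseteq> S" using t by (auto simp: test_function_def K_def)
  have z: "\<phi> x = 0" "D\<phi> x = 0" if "x \<notin> K" for x
    using that[unfolded K_def] closure_subset[of "{x. \<phi> x \<noteq> 0}"] test_function_gradient_zero[OF t D] by auto
  have cp: "continuous_on UNIV \<psi>"
    using D' unfolding gderiv_def continuous_on_eq_continuous_within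
    by (auto intro: has_derivative_continuous)
  note cs = test_function_continuous[OF t] test_function_gradient_continuous[OF t D] cp c
  have c1: "continuous_on UNIV (\<lambda>x. \<psi> x * (D\<phi> x \<bullet> b))" "continuous_on UNIV (\<lambda>x. \<phi> x * (D\<psi> x \<bullet> b))"
    by (intro continuous_intros cs)+
  have i1: "integrable (lebesgue_on S) (\<lambda>x. \<psi> x * (D\<phi> x \<bullet> b))"
    "(LINT x|lebesgue_on S. \<psi> x * (D\<phi> x \<bullet> b)) = (LINT x|lborel. \<psi> x * (D\<phi> x \<bullet> b))"
    "integrable lborel (\<lambda>x. \<psi> x * (D\<phi> x \<bullet> b))"
    by (rule lebesgue_on_continuous_compact_support[OF c1(1) K(1) _ K(2) S]
        integrable_continuous_compact_support[OF c1(1) K(1)], simp add: z)+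
  have i2: "integrable (lebesgue_on S) (\<lambda>x. \<phi> x * (D\<psi> x \<bullet> b))"
    "(LINT x|lebesgue_on S. \<phi> x * (D\<psi> x \<bullet> b)) = (LINT x|lborel. \<phi> x * (D\<psi> x \<bullet> b))"
    "integrable lborel (\<lambda>x. \<phi> x * (D\<psi> x \<bullet> b))"
    by (rule lebesgue_on_continuous_compact_support[OF c1(2) K(1) _ K(2) S]
        integrable_continuous_compact_support[OF c1(2) K(1)], simp add: z)+
  have "(LINT x|lborel. b \<bullet> (\<phi> x *\<^sub>R D\<psi> x + \<psi> x *\<^sub>R D\<phi> x)) = 0"
  proof (rule integral_directional_derivative_eq_0)
    show "((\<lambda>x. \<phi> x * \<psi> x) has_derivative (\<lambda>h. h \<bullet> (\<phi> x *\<^sub>R D\<psi> x + \<psi> x *\<^sub>R D\<phi> x))) (at x)" for x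
      using GDERIV_mult[OF D D', of x] by (simp add: gderiv_def)
    show "continuous_on UNIV (\<lambda>x. b \<bullet> (\<phi> x *\<^sub>R D\<psi> x + \<psi> x *\<^sub>R D\<phi> x))"
      by (intro continuous_intros cs)
  qed (use K(1) in simp, simp add: z)
  then have "(LINT x|lborel. \<phi> x * (D\<psi> x \<bullet> b) + \<psi> x * (D\<phi> x \<bullet> b)) = 0"
    by (simp add: inner_add_right inner_commute)
  then show "(LINT x|lebesgue_on S. \<psi> x * (D\<phi> x \<bullet> b)) = - (LINT x|lebesgue_on S. \<phi> x * (D\<psi> x \<bullet> b))"
    using i1 i2 by simp
  show "integrable (lebesgue_on S) (\<lambda>x. \<psi> x * (D\<phi> x \<bullet> b))"
    and "integrable (lebesgue_on S) (\<lambda>x. \<phi> x * (D\<psi> x \<bullet> b))"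
    by (fact i1 i2)+
qed

section \<open>A smooth cutoff profile\<close>

text \<open>For \<open>t > 0\<close> this is \<open>t\<^sup>1\<^sup>-\<^sup>j exp (- 1 / t)\<close>. The powers are there because the span of
  these functions is closed under differentiation, which makes every one of them smooth, while
  \<open>flat 0\<close> is a smooth function that vanishes for \<open>t \<le> 0\<close> and has slope tending to one at infinity.\<close>

definition flat :: "nat \<Rightarrow> real \<Rightarrow> real" where
  "flat j t = (if t > 0 then t * inverse t ^ j * exp (- inverse t) else 0)"

lemma has_real_derivative_flat:
  "(flat j has_real_derivative (1 - real j) * flat (Suc j) t + flat (Suc (Suc j)) t) (at t)"
proof (cases "t = 0")
  case True
  have 1: "((\<lambda>h. inverse h ^ j / exp (inverse h)) \<longlongrightarrow> 0) (at_right (0::real))"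
    by (rule filterlim_compose[OF tendsto_power_div_exp_0 filterlim_inverse_at_top_right])
  have "((\<lambda>h. flat j h / h) \<longlongrightarrow> 0) (at_right 0)"
    by (rule Lim_transform_eventually[OF 1])
      (auto simp: flat_def exp_minus field_simps eventually_at_filter)
  moreover have "((\<lambda>h. flat j h / h) \<longlongrightarrow> 0) (at_left 0)"
    by (rule Lim_transform_eventually[OF tendsto_const])
      (auto simp: flat_def eventually_at_filter)
  ultimately have "((\<lambda>h. flat j h / h) \<longlongrightarrow> 0) (at 0)"
    by (simp add: filterlim_split_at)
  then show ?thesis using True by (simp add: DERIV_def flat_def)
next
  case False
  show ?thesis
  proof (cases "t > 0")
    case True
    have p: "((\<lambda>t. inverse t ^ j) has_real_derivative - real j * inverse t ^ Suc j) (at t)"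
    proof (cases j)
      case (Suc i)
      have "real i * inverse t ^ (i - Suc 0) * inverse t = real i * inverse t ^ i"
        by (cases i) auto
      then show ?thesis
        unfolding Suc using True
        by (auto intro!: derivative_eq_intros simp: algebra_simps)
    qed simp
    have "((\<lambda>t. t * inverse t ^ j * exp (- inverse t)) has_real_derivative
        (1 - real j) * flat (Suc j) t + flat (Suc (Suc j)) t) (at t)"
    proof (rule DERIV_cong)
      have "(exp \<circ> (\<lambda>t. - inverse t) has_real_derivative exp (- inverse t) * (inverse t)\<^sup>2) (at t)"
        unfolding o_def using True by (auto intro!: derivative_eq_intros simp: power2_eq_square)
      then have e: "((\<lambda>t. exp (- inverse t)) has_real_derivative exp (- inverse t) * (inverse t)\<^sup>2) (at t)"
        by (simp add: o_def)
      show "((\<lambda>t. t * inverse t ^ j * exp (- inverse t)) has_real_derivative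
          (1 * inverse t ^ j + - real j * inverse t ^ Suc j * t) * exp (- inverse t)
            + exp (- inverse t) * (inverse t)\<^sup>2 * (t * inverse t ^ j)) (at t)"
        by (intro DERIV_mult DERIV_ident p e)
      have 1: "t * inverse t ^ Suc j = inverse t ^ j" using True by simp
      have 2: "flat (Suc j) t = inverse t ^ j * exp (- inverse t)"
        "flat (Suc (Suc j)) t = (t * inverse t ^ j * exp (- inverse t)) * (inverse t)\<^sup>2"
        using True 1 by (auto simp: flat_def power2_eq_square)
      show "(1 * inverse t ^ j + - real j * inverse t ^ Suc j * t) * exp (- inverse t)
            + exp (- inverse t) * (inverse t)\<^sup>2 * (t * inverse t ^ j)
        = (1 - real j) * flat (Suc j) t + flat (Suc (Suc j)) t"
        unfolding 2 using arg_cong[OF 1, of "\<lambda>s. s * real j * exp (- inverse t)"]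
        by (simp only: algebra_simps)
    qed
    then show ?thesis
      by (rule has_field_derivative_transform_within_open[of _ _ _ "{0<..}"]) (use True in \<open>auto simp: flat_def\<close>)
  next
    case False
    have "((\<lambda>_. 0) has_real_derivative (1 - real j) * flat (Suc j) t + flat (Suc (Suc j)) t) (at t)"
      using False by (simp add: flat_def)
    then show ?thesis
      by (rule has_field_derivative_transform_within_open[of _ _ _ "{..<0}"])
        (use False \<open>t \<noteq> 0\<close> in \<open>auto simp: flat_def\<close>)
  qed
qed

lemma flat_0_bounds: "0 \<le> flat 0 t" "flat 0 t \<le> max 0 t"
  by (auto simp: flat_def mult_left_le)

text \<open>The sum is the derivative of \<open>flat 0\<close>; with \<open>y = 1 / t\<close> it equals \<open>(1 + y) exp (- y)\<close>,
  and \<open>1 + y \<le> exp y\<close>.\<close>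

lemma flat_slope_bounds: "0 \<le> flat 1 t + flat 2 t" "flat 1 t + flat 2 t \<le> 1"
proof -
  have "t * inverse t * exp (- inverse t) + t * (inverse t)\<^sup>2 * exp (- inverse t)
     = (1 + inverse t) / exp (inverse t)" if "t > 0"
    using that by (simp add: power2_eq_square exp_minus field_simps)
  then show "0 \<le> flat 1 t + flat 2 t" "flat 1 t + flat 2 t \<le> 1"
    using exp_ge_add_one_self[of "inverse t"] by (auto simp: flat_def)
qed

text \<open>A small syntactic class, closed under directional derivatives, that contains the cutoffs used below;
  for it the iterated differentiability in \<^const>\<open>Ck\<close> is a plain induction.\<close>

inductive smooth_function :: "('a::euclidean_space \<Rightarrow> real) \<Rightarrow> bool" where
  const: "smooth_function (\<lambda>_. c)"
| linear: "smooth_function (\<lambda>x. x \<bullet> b)"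
| square: "smooth_function (\<lambda>x. x \<bullet> x)"
| add: "smooth_function f \<Longrightarrow> smooth_function g \<Longrightarrow> smooth_function (\<lambda>x. f x + g x)"
| mult: "smooth_function f \<Longrightarrow> smooth_function g \<Longrightarrow> smooth_function (\<lambda>x. f x * g x)"
| flat: "smooth_function f \<Longrightarrow> smooth_function (\<lambda>x. flat j (f x))"

lemma smooth_function_derivative:
  "smooth_function f \<Longrightarrow>
    \<exists>f'. (\<forall>x. (f has_derivative f' x) (at x)) \<and> (\<forall>b. smooth_function (\<lambda>x. f' x b))"
proof (induction rule: smooth_function.induct)
  case (const c)
  show ?case by (rule exI[of _ "\<lambda>_ _. 0"]) (auto intro: smooth_function.intros)
next
  case (linear b)
  show ?case
    by (rule exI[of _ "\<lambda>_ h. h \<bullet> b"]) (auto intro: smooth_function.intros intro!: derivative_eq_intros)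
next
  case square
  have "smooth_function (\<lambda>x. x \<bullet> b + x \<bullet> b)" for b :: 'a
    by (intro smooth_function.intros)
  then show ?case
    by (intro exI[of _ "\<lambda>x h. x \<bullet> h + x \<bullet> h"])
      (auto intro!: derivative_eq_intros simp: inner_commute)
next
  case (add f g)
  then obtain f' g' where "\<And>x. (f has_derivative f' x) (at x)" "\<And>b. smooth_function (\<lambda>x. f' x b)"
    "\<And>x. (g has_derivative g' x) (at x)" "\<And>b. smooth_function (\<lambda>x. g' x b)" by auto
  then show ?case
    by (intro exI[of _ "\<lambda>x h. f' x h + g' x h"]) (auto intro: smooth_function.intros has_derivative_add)
next
  case (mult f g)
  then obtain f' g' where "\<And>x. (f has_derivative f' x) (at x)" "\<And>b. smooth_function (\<lambda>x. f' x b)"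
    "\<And>x. (g has_derivative g' x) (at x)" "\<And>b. smooth_function (\<lambda>x. g' x b)" by auto
  moreover from this have "smooth_function (\<lambda>x. f x * g' x b + f' x b * g x)" for b
    by (intro smooth_function.add smooth_function.mult mult.hyps)
  ultimately show ?case
    by (intro exI[of _ "\<lambda>x h. f x * g' x h + f' x h * g x"]) (auto intro: has_derivative_mult)
next
  case (flat f j)
  then obtain f' where f': "\<And>x. (f has_derivative f' x) (at x)" "\<And>b. smooth_function (\<lambda>x. f' x b)"
    by auto
  show ?case
  proof (intro exI[of _ "\<lambda>x h. f' x h * ((1 - real j) * flat (Suc j) (f x) + flat (Suc (Suc j)) (f x))"] conjI allI)
    fix x
    show "((\<lambda>x. flat j (f x)) has_derivative
       (\<lambda>h. f' x h * ((1 - real j) * flat (Suc j) (f x) + flat (Suc (Suc j)) (f x)))) (at x)"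
      using has_derivative_compose[OF f'(1) has_real_derivative_flat[unfolded has_field_derivative_def]]
      by (simp add: mult.commute)
  next
    fix b
    show "smooth_function
      (\<lambda>x. f' x b * ((1 - real j) * flat (Suc j) (f x) + flat (Suc (Suc j)) (f x)))"
      by (intro smooth_function.intros f'(2) flat.hyps)
  qed
qed

lemma Ck_smooth_function: "smooth_function f \<Longrightarrow> Ck k f"
proof (induction k arbitrary: f)
  case 0
  then show ?case
    using smooth_function_derivative[OF 0]
    by (auto simp: continuous_on_eq_continuous_within intro: has_derivative_continuous)
next
  case (Suc k)
  obtain f' where f': "\<And>x. (f has_derivative f' x) (at x)" "\<And>b. smooth_function (\<lambda>x. f' x b)"
    using smooth_function_derivative[OF Suc.prems] by blast
  have "frechet_derivative f (at x) = f' x" for x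
    using frechet_derivative_at[OF f'(1)] by simp
  then show ?case
    using f' Suc.IH by (auto simp: differentiable_def)
qed

section \<open>Square integrable functions on a ball\<close>

lemma lebesgue_on_measurable_continuous:
  fixes f :: "'a::euclidean_space \<Rightarrow> 'b::euclidean_space"
  assumes "continuous_on UNIV f"
  shows "f \<in> borel_measurable (lebesgue_on S)"
  using borel_measurable_continuous_onI[OF assms]
  by (intro measurable_restrict_space1 measurable_completion) simp

lemma finite_measure_lebesgue_on_ball: "finite_measure (lebesgue_on (ball (c::'a::euclidean_space) R))"
  by (simp add: finite_measure_lebesgue_on)

lemma L2_on_ball_continuous:
  fixes f :: "'a::euclidean_space \<Rightarrow> 'b::euclidean_space"
  assumes "continuous_on UNIV f"
  shows "L2_on (ball c R) f"
proof -
  interpret finite_measure "lebesgue_on (ball c R)"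
    by (rule finite_measure_lebesgue_on_ball)
  have c2: "continuous_on UNIV (\<lambda>x. (norm (f x))\<^sup>2)"
    by (intro continuous_intros assms)
  have "bounded ((\<lambda>x. (norm (f x))\<^sup>2) ` cball c R)"
    by (intro compact_imp_bounded compact_continuous_image continuous_on_subset[OF c2]) auto
  then obtain M where "\<forall>x\<in>cball c R. (norm (f x))\<^sup>2 \<le> M"
    by (auto simp: bounded_iff simp del: mem_cball)
  then have "integrable (lebesgue_on (ball c R)) (\<lambda>x. (norm (f x))\<^sup>2)"
    by (intro integrable_const_bound[of _ M] AE_I2 lebesgue_on_measurable_continuous[OF c2])
      (auto simp: space_restrict_space)
  then show ?thesis
    using lebesgue_on_measurable_continuous[OF assms] by (simp add: L2_on_def)
qed

lemma integrable_L2_on_ball: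
  fixes v :: "'a::euclidean_space \<Rightarrow> real"
  assumes "L2_on (ball c R) v"
  shows "integrable (lebesgue_on (ball c R)) v"
proof -
  interpret finite_measure "lebesgue_on (ball c R)"
    by (rule finite_measure_lebesgue_on_ball)
  have "v \<in> borel_measurable (lebesgue_on (ball c R))"
    "integrable (lebesgue_on (ball c R)) (\<lambda>x. (v x)\<^sup>2)"
    using assms by (simp_all add: L2_on_def)
  then show ?thesis by (rule square_integrable_imp_integrable)
qed

section \<open>The torsion function of the unit ball\<close>

text \<open>The solution of \<open>-\<Delta>w = 1\<close> in the unit ball that vanishes on the boundary.\<close>

definition torsion :: "'a::euclidean_space \<Rightarrow> real" where
  "torsion x = (1 - x \<bullet> x) / (2 * real DIM('a))"

definition grad_torsion :: "'a::euclidean_space \<Rightarrow> 'a" where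
  "grad_torsion x = - (1 / real DIM('a)) *\<^sub>R x"

lemma GDERIV_torsion: "GDERIV torsion x :> grad_torsion x"
  unfolding torsion_def grad_torsion_def gderiv_def
  by (auto intro!: derivative_eq_intros simp: inner_commute fun_eq_iff field_simps)

lemma continuous_grad_torsion: "continuous_on UNIV (grad_torsion :: 'a::euclidean_space \<Rightarrow> 'a)"
  unfolding grad_torsion_def by (intro continuous_intros)

lemma continuous_torsion: "continuous_on UNIV (torsion :: 'a::euclidean_space \<Rightarrow> real)"
  unfolding torsion_def by (intro continuous_intros) auto

text \<open>Compactly supported approximations of \<^const>\<open>torsion\<close>: with \<open>\<rho> = flat 0\<close>, the function
  \<open>s \<mapsto> \<rho> (K s - 1) / K\<close> is smooth, vanishes for \<open>s \<le> 1 / K\<close>, and approaches \<open>s\<close> with slope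
  between zero and one. Inserting \<open>s = 1 - |x|\<^sup>2\<close> cuts the torsion function off near the boundary
  while its gradient is only multiplied by a factor between zero and one.\<close>

definition torsion_approx :: "real \<Rightarrow> 'a::euclidean_space \<Rightarrow> real" where
  "torsion_approx K x = flat 0 (K * (1 - x \<bullet> x) - 1) / (2 * real DIM('a) * K)"

definition grad_torsion_approx :: "real \<Rightarrow> 'a::euclidean_space \<Rightarrow> 'a" where
  "grad_torsion_approx K x =
     (flat 1 (K * (1 - x \<bullet> x) - 1) + flat 2 (K * (1 - x \<bullet> x) - 1)) *\<^sub>R grad_torsion x"

lemma GDERIV_torsion_approx:
  assumes "K > 0"
  shows "GDERIV (torsion_approx K) (x::'a::euclidean_space) :> grad_torsion_approx K x"
proof -
  let ?s = "\<lambda>x::'a. K * (1 - x \<bullet> x) - 1"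
  have "GDERIV ?s x :> (- 2 * K) *\<^sub>R x"
    unfolding gderiv_def
    by (auto intro!: derivative_eq_intros simp: inner_commute fun_eq_iff)
  from GDERIV_DERIV_compose[OF this has_real_derivative_flat[of 0]]
  have "GDERIV (\<lambda>x. flat 0 (?s x)) x :> (flat 1 (?s x) + flat 2 (?s x)) *\<^sub>R (- 2 * K) *\<^sub>R x"
    by (simp add: numeral_2_eq_2)
  from GDERIV_mult[OF this GDERIV_const[of "1 / (2 * real DIM('a) * K)"]]
  show ?thesis
    using assms unfolding torsion_approx_def[abs_def] grad_torsion_approx_def grad_torsion_def
    by (simp add: scaleR_add_left add_divide_distrib algebra_simps)
qed

text \<open>The support lies in the closed ball of radius \<open>(1 - 1 / K)\<^sup>1\<^sup>/\<^sup>2 < 1\<close>, or is empty if \<open>K \<le> 1\<close>.\<close>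

lemma test_function_torsion_approx:
  assumes "K > 0"
  shows "test_function (ball 0 1) (torsion_approx K :: 'a::euclidean_space \<Rightarrow> real)"
proof -
  have "smooth_function (\<lambda>x::'a. flat 0 (K * (1 + (-1) * (x \<bullet> x)) + (-1)) * (1 / (2 * real DIM('a) * K)))"
    by (intro smooth_function.intros)
  then have "smooth_function (torsion_approx K :: 'a \<Rightarrow> real)"
    by (simp add: torsion_approx_def[abs_def])
  moreover have sub: "closure {x::'a. torsion_approx K x \<noteq> 0} \<subseteq> cball 0 (sqrt (max 0 (1 - 1 / K)))"
  proof (rule closure_minimal)
    show "{x::'a. torsion_approx K x \<noteq> 0} \<subseteq> cball 0 (sqrt (max 0 (1 - 1 / K)))"
    proof
      fix x :: 'a
      assume "x \<in> {x. torsion_approx K x \<noteq> 0}"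
      then have "K * (1 - x \<bullet> x) - 1 > 0" 
        by (auto simp: torsion_approx_def flat_def split: if_splits)
      then have "x \<bullet> x \<le> 1 - 1 / K"
        using assms by (simp add: field_simps)
      then show "x \<in> cball 0 (sqrt (max 0 (1 - 1 / K)))"
        by (simp add: norm_eq_sqrt_inner)
    qed
  qed simp
  moreover have "sqrt (max 0 (1 - 1 / K)) < 1"
    using assms by (simp add: real_sqrt_lt_1_iff)
  then have "cball 0 (sqrt (max 0 (1 - 1 / K))) \<subseteq> ball (0::'a) 1"
    by (intro cball_subset_ball_iff[THEN iffD2]) simp
  moreover have "compact (closure {x::'a. torsion_approx K x \<noteq> 0})"
    using bounded_subset[OF bounded_cball sub] by (simp add: compact_eq_bounded_closed)
  ultimately show ?thesis
    unfolding test_function_def using Ck_smooth_function by blast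
qed

lemma flat_limits:
  assumes "a > 0"
  shows "(\<lambda>k. flat 0 (real (Suc k) * a - 1) / real (Suc k)) \<longlonglongrightarrow> a"
    and "(\<lambda>k. flat 1 (real (Suc k) * a - 1) + flat 2 (real (Suc k) * a - 1)) \<longlonglongrightarrow> 1"
proof -
  define t where "t k = real (Suc k) * a - 1" for k
  have "filterlim (\<lambda>k. real (Suc k)) at_top sequentially"
    by (rule filterlim_compose[OF filterlim_real_sequentially filterlim_Suc])
  from filterlim_tendsto_add_at_top[OF tendsto_const[of "-1"] filterlim_at_top_mult_tendsto_pos[OF tendsto_const assms this]]
  have ft: "filterlim t at_top sequentially"
    by (simp add: t_def[abs_def])
  then have pos: "eventually (\<lambda>k. t k > 0) sequentially"
    by (rule eventually_compose_filterlim[OF eventually_gt_at_top])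
  have i: "(\<lambda>k. inverse (t k)) \<longlonglongrightarrow> 0"
    by (rule filterlim_compose[OF tendsto_inverse_0_at_top[OF filterlim_ident] ft])
  have "(\<lambda>k. (a - inverse (real (Suc k))) * exp (- inverse (t k))) \<longlonglongrightarrow> (a - 0) * exp (- 0)"
    by (intro tendsto_intros i LIMSEQ_inverse_real_of_nat)
  then have "(\<lambda>k. flat 0 (t k) / real (Suc k)) \<longlonglongrightarrow> (a - 0) * exp (- 0)"
  proof (rule Lim_transform_eventually)
    show "\<forall>\<^sub>F k in sequentially. (a - inverse (real (Suc k))) * exp (- inverse (t k)) = flat 0 (t k) / real (Suc k)"
      using pos by eventually_elim (simp add: flat_def t_def field_simps)
  qed
  then show "(\<lambda>k. flat 0 (real (Suc k) * a - 1) / real (Suc k)) \<longlonglongrightarrow> a"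
    by (simp add: t_def)
  have "(\<lambda>k. (1 + inverse (t k)) * exp (- inverse (t k))) \<longlonglongrightarrow> (1 + 0) * exp (- 0)"
    by (intro tendsto_intros i)
  then have "(\<lambda>k. flat 1 (t k) + flat 2 (t k)) \<longlonglongrightarrow> (1 + 0) * exp (- 0)"
  proof (rule Lim_transform_eventually)
    show "\<forall>\<^sub>F k in sequentially. (1 + inverse (t k)) * exp (- inverse (t k)) = flat 1 (t k) + flat 2 (t k)"
      using pos by eventually_elim (simp add: flat_def power2_eq_square field_simps)
  qed
  then show "(\<lambda>k. flat 1 (real (Suc k) * a - 1) + flat 2 (real (Suc k) * a - 1)) \<longlonglongrightarrow> 1"
    by (simp add: t_def)
qed

lemma integrable_if_components_integrable:
  fixes f :: "'b \<Rightarrow> 'a::euclidean_space"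
  assumes "\<And>b. b \<in> Basis \<Longrightarrow> integrable M (\<lambda>x. f x \<bullet> b)"
  shows "integrable M f"
proof -
  have "integrable M (\<lambda>x. \<Sum>b\<in>Basis. (f x \<bullet> b) *\<^sub>R b)"
    using assms by (intro Bochner_Integration.integrable_sum integrable_scaleR_left) auto
  then show ?thesis by (simp add: euclidean_representation)
qed

lemma weak_gradient_GDERIV:
  fixes \<psi> :: "'a::euclidean_space \<Rightarrow> real"
  assumes D': "\<And>x. GDERIV \<psi> x :> D\<psi> x" and c: "continuous_on UNIV D\<psi>"
    and S: "S \<in> sets lebesgue"
  shows "weak_gradient S \<psi> D\<psi>"
  unfolding weak_gradient_def
proof (intro allI impI)
  fix \<phi> D\<phi> assume t: "test_function S \<phi>" and "\<forall>x. GDERIV \<phi> x :> D\<phi> x"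
  then have D: "\<And>x. GDERIV \<phi> x :> D\<phi> x" by blast
  note ibp = integral_by_parts_test_function[OF t D D' c S]
  have int: "integrable (lebesgue_on S) (\<lambda>x. \<psi> x *\<^sub>R D\<phi> x)" "integrable (lebesgue_on S) (\<lambda>x. \<phi> x *\<^sub>R D\<psi> x)"
    by (rule integrable_if_components_integrable, use ibp(1,2) in simp)+
  show "(LINT x|lebesgue_on S. \<psi> x *\<^sub>R D\<phi> x) = - (LINT x|lebesgue_on S. \<phi> x *\<^sub>R D\<psi> x)"
  proof (rule euclidean_eqI)
    fix b :: 'a
    show "(LINT x|lebesgue_on S. \<psi> x *\<^sub>R D\<phi> x) \<bullet> b = - (LINT x|lebesgue_on S. \<phi> x *\<^sub>R D\<psi> x) \<bullet> b"
      unfolding inner_minus_left integral_inner_left[OF int(1), symmetric]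
        integral_inner_left[OF int(2), symmetric] inner_scaleR_left
      by (rule ibp(3))
  qed
qed

text \<open>The constant bound that dominates the squared Sobolev distance: both \<open>0 \<le> torsion_approx K \<le> torsion\<close>
  and the bounds on the slope of \<open>flat 0\<close> are uniform in \<open>K\<close>.\<close>

lemma torsion_approx_error:
  assumes "K > 0" "x \<in> ball (0::'a::euclidean_space) 1"
  shows "(torsion_approx K x - torsion x)\<^sup>2 + (norm (grad_torsion_approx K x - grad_torsion x))\<^sup>2 \<le> 2"
proof -
  let ?n = "real DIM('a)"
  have n: "?n \<ge> 1" using DIM_positive[where 'a='a] by linarith
  have x: "x \<bullet> x < 1" using assms(2) by (simp add: dot_square_norm abs_square_less_1)
  let ?s = "K * (1 - x \<bullet> x) - 1"
  have "torsion_approx K x \<le> torsion x" "0 \<le> torsion_approx K x"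
  proof -
    have "flat 0 ?s \<le> K * (1 - x \<bullet> x)" using flat_0_bounds(2)[of ?s] mult_pos_pos[OF assms(1), of "1 - x \<bullet> x"] x by linarith
    then have "flat 0 ?s / K \<le> 1 - x \<bullet> x" using assms(1) by (simp add: field_simps)
    then have "(flat 0 ?s / K) / (2 * ?n) \<le> (1 - x \<bullet> x) / (2 * ?n)" 
      by (rule divide_right_mono) simp
    then show "torsion_approx K x \<le> torsion x" by (simp add: torsion_approx_def torsion_def mult.commute)
    show "0 \<le> torsion_approx K x"
      using flat_0_bounds(1) assms(1) by (simp add: torsion_approx_def)
  qed
  moreover have "torsion x \<le> 1"
    using n by (simp add: torsion_def field_simps) (use inner_ge_zero[of x] n in linarith)
  ultimately have "\<bar>torsion_approx K x - torsion x\<bar> \<le> 1" by linarith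
  then have 1: "(torsion_approx K x - torsion x)\<^sup>2 \<le> 1" by (simp add: abs_square_le_1)
  have g: "norm (grad_torsion x) \<le> 1"
  proof -
    have "norm x \<le> ?n"
      using assms(2) n unfolding mem_ball dist_0_norm by linarith
    then show ?thesis by (simp add: grad_torsion_def field_simps)
  qed
  have "norm (grad_torsion_approx K x - grad_torsion x) = \<bar>flat 1 ?s + flat 2 ?s - 1\<bar> * norm (grad_torsion x)"
    unfolding grad_torsion_approx_def norm_scaleR[symmetric] scaleR_left_diff_distrib by simp
  also have "\<dots> \<le> 1 * 1"
    using flat_slope_bounds[of ?s] g by (intro mult_mono) auto
  finally have "(norm (grad_torsion_approx K x - grad_torsion x))\<^sup>2 \<le> 1"
    by (simp add: abs_square_le_1)
  with 1 show ?thesis by linarith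
qed

text \<open>Values and gradients of the approximations converge pointwise in the open ball, and the errors are
  uniformly bounded; dominated convergence gives convergence in the Sobolev norm.\<close>

lemma H10_torsion: "H10 (ball (0::'a::euclidean_space) 1) torsion grad_torsion"
  unfolding H10_def H1_def
proof (intro conjI exI[of _ "\<lambda>k. torsion_approx (real (Suc k))"] exI[of _ "\<lambda>k. grad_torsion_approx (real (Suc k))"] allI)
  let ?B = "ball (0::'a) 1"
  interpret finite_measure "lebesgue_on ?B"
    by (rule finite_measure_lebesgue_on_ball)
  show "L2_on ?B torsion" "L2_on ?B grad_torsion"
    by (intro L2_on_ball_continuous continuous_torsion continuous_grad_torsion)+
  show "weak_gradient ?B torsion grad_torsion"
    by (intro weak_gradient_GDERIV GDERIV_torsion continuous_grad_torsion) simp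
  show "test_function ?B (torsion_approx (real (Suc k)))" for k
    by (rule test_function_torsion_approx) simp
  show "GDERIV (torsion_approx (real (Suc k))) x :> grad_torsion_approx (real (Suc k)) x" for k and x :: 'a
    by (rule GDERIV_torsion_approx) simp
  let ?Q = "\<lambda>k x. (torsion_approx (real (Suc k)) x - torsion x)\<^sup>2
      + (norm (grad_torsion_approx (real (Suc k)) x - grad_torsion x :: 'a))\<^sup>2"
  have "(\<lambda>k. LINT x|lebesgue_on ?B. ?Q k x) \<longlonglongrightarrow> (LINT x|lebesgue_on ?B. 0)"
  proof (rule integral_dominated_convergence[where w="\<lambda>_. 2"])
    show "?Q k \<in> borel_measurable (lebesgue_on ?B)" for k
    proof (rule lebesgue_on_measurable_continuous)
      have t: "test_function ?B (torsion_approx (real (Suc k)))"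
        by (rule test_function_torsion_approx) simp
      have "continuous_on UNIV (grad_torsion_approx (real (Suc k)) :: 'a \<Rightarrow> 'a)"
        by (rule test_function_gradient_continuous[OF t GDERIV_torsion_approx]) simp
      then show "continuous_on UNIV (?Q k)"
        by (intro continuous_intros test_function_continuous[OF t] continuous_torsion continuous_grad_torsion)
    qed
    show "AE x in lebesgue_on ?B. (\<lambda>k. ?Q k x) \<longlonglongrightarrow> 0"
    proof (rule AE_I2)
      fix x :: 'a assume "x \<in> space (lebesgue_on ?B)"
      then have x: "1 - x \<bullet> x > 0" by (simp add: space_restrict_space dot_square_norm abs_square_less_1)
      have "(\<lambda>k. (flat 0 (real (Suc k) * (1 - x \<bullet> x) - 1) / real (Suc k)) / (2 * real DIM('a))) \<longlonglongrightarrow> torsion x"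
        unfolding torsion_def by (intro tendsto_divide flat_limits(1)[OF x] tendsto_const) simp
      then have 1: "(\<lambda>k. torsion_approx (real (Suc k)) x) \<longlonglongrightarrow> torsion x"
        by (simp add: torsion_approx_def mult.commute del: of_nat_Suc)
      have 2: "(\<lambda>k. grad_torsion_approx (real (Suc k)) x) \<longlonglongrightarrow> 1 *\<^sub>R grad_torsion x"
        unfolding grad_torsion_approx_def by (intro tendsto_scaleR flat_limits(2)[OF x] tendsto_const)
      have "(\<lambda>k. ?Q k x) \<longlonglongrightarrow> (torsion x - torsion x)\<^sup>2 + (norm (1 *\<^sub>R grad_torsion x - grad_torsion x))\<^sup>2"
        by (intro tendsto_intros 1 2)
      then show "(\<lambda>k. ?Q k x) \<longlonglongrightarrow> 0" by simp
    qed
    show "AE x in lebesgue_on ?B. norm (?Q k x) \<le> 2" for k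
      using torsion_approx_error[of "real (Suc k)"]
      by (intro AE_I2) (auto simp: space_restrict_space simp del: of_nat_Suc)
  qed simp_all
  then show "(\<lambda>k. LINT x|lebesgue_on ?B. ?Q k x) \<longlonglongrightarrow> 0"
    by simp
qed

section \<open>Duality with the torsion function\<close>

text \<open>On a finite measure space Cauchy-Schwarz bounds the square of the integral by the total mass times
  the integral of the square.\<close>

lemma (in finite_measure) integral_tendsto_0_if_integral_square_tendsto_0:
  fixes F :: "nat \<Rightarrow> 'a \<Rightarrow> real"
  assumes F: "\<And>k. F k \<in> borel_measurable M" "\<And>k. integrable M (\<lambda>x. (F k x)\<^sup>2)"
    and lim: "(\<lambda>k. LINT x|M. (F k x)\<^sup>2) \<longlonglongrightarrow> 0"
  shows "(\<lambda>k. LINT x|M. F k x) \<longlonglongrightarrow> 0"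
proof -
  have bound: "(LINT x|M. F k x)\<^sup>2 \<le> measure M (space M) * (LINT x|M. (F k x)\<^sup>2)" for k
  proof -
    let ?I = "LINT x|M. F k x" and ?\<mu> = "measure M (space M)"
    have i: "integrable M (F k)"
      using square_integrable_imp_integrable[OF F(1) F(2)] .
    \<comment> \<open>The variance of \<open>F k\<close>, scaled by the total mass so that no division is needed.\<close>
    have "0 \<le> (LINT x|M. (?\<mu> * F k x - ?I)\<^sup>2)" by simp
    also have "\<dots> = (LINT x|M. ?\<mu>\<^sup>2 * (F k x)\<^sup>2 - 2 * ?\<mu> * ?I * F k x + ?I\<^sup>2)"
      by (simp add: power2_eq_square algebra_simps)
    also have "\<dots> = ?\<mu>\<^sup>2 * (LINT x|M. (F k x)\<^sup>2) - 2 * ?\<mu> * ?I * ?I + ?I\<^sup>2 * ?\<mu>"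
      using i F(2)[of k] by simp
    also have "\<dots> = ?\<mu> * (?\<mu> * (LINT x|M. (F k x)\<^sup>2) - ?I\<^sup>2)"
      by (simp add: power2_eq_square algebra_simps)
    finally have 1: "0 \<le> ?\<mu> * (?\<mu> * (LINT x|M. (F k x)\<^sup>2) - ?I\<^sup>2)" .
    show ?thesis
    proof (cases "?\<mu> = 0")
      case True
      then have "space M \<in> null_sets M"
        by (simp add: null_sets_def emeasure_eq_measure)
      then have "AE x in M. F k x = 0"
        by (rule AE_I') auto
      then have "?I = 0"
        using integral_eq_zero_AE by blast
      then show ?thesis using True by simp
    next
      case False
      then have "?\<mu> > 0" by (simp add: zero_less_measure_iff)
      with 1 show ?thesis by (simp add: zero_le_mult_iff)
    qed
  qed
  have upper: "(\<lambda>k. measure M (space M) * (LINT x|M. (F k x)\<^sup>2)) \<longlonglongrightarrow> 0"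
    using tendsto_mult[OF tendsto_const lim] by simp
  have "(\<lambda>k. (LINT x|M. F k x)\<^sup>2) \<longlonglongrightarrow> 0"
    by (rule tendsto_sandwich[OF _ _ tendsto_const upper]) (intro always_eventually allI bound zero_le_power2)+
  then show ?thesis
    by (simp add: power_tendsto_0_iff)
qed

text \<open>Integration by parts against each coordinate function, summed over the basis: the position field has
  divergence equal to the dimension.\<close>

lemma test_function_divergence:
  fixes \<phi> :: "'a::euclidean_space \<Rightarrow> real"
  assumes t: "test_function S \<phi>" and D: "\<And>x. GDERIV \<phi> x :> D\<phi> x" and S: "S \<in> sets lebesgue"
  shows "(LINT x|lebesgue_on S. D\<phi> x \<bullet> x) = - real DIM('a) * (LINT x|lebesgue_on S. \<phi> x)"
proof -
  have G: "GDERIV (\<lambda>x. x \<bullet> b) x :> b" for b x :: 'a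
    unfolding gderiv_def by (auto intro!: derivative_eq_intros)
  note ibp = integral_by_parts_test_function[OF t D G continuous_on_const S]
  have "(LINT x|lebesgue_on S. D\<phi> x \<bullet> x) = (LINT x|lebesgue_on S. (\<Sum>b\<in>Basis. (x \<bullet> b) * (D\<phi> x \<bullet> b)))"
  proof (rule Bochner_Integration.integral_cong[OF refl])
    fix x
    show "D\<phi> x \<bullet> x = (\<Sum>b\<in>Basis. (x \<bullet> b) * (D\<phi> x \<bullet> b))"
      by (subst euclidean_inner) (simp only: mult.commute)
  qed
  also have "\<dots> = (\<Sum>b\<in>Basis. LINT x|lebesgue_on S. (x \<bullet> b) * (D\<phi> x \<bullet> b))"
    by (intro Bochner_Integration.integral_sum ibp(1))
  also have "\<dots> = (\<Sum>b\<in>(Basis::'a set). - (LINT x|lebesgue_on S. \<phi> x))"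
    by (intro sum.cong refl) (simp add: ibp(3) inner_same_Basis)
  finally show ?thesis by simp
qed

lemma L2_on_diff_norm_square_integrable:
  fixes f g :: "'a::euclidean_space \<Rightarrow> 'b::euclidean_space"
  assumes "L2_on S f" "L2_on S g"
  shows "integrable (lebesgue_on S) (\<lambda>x. (norm (f x - g x))\<^sup>2)"
proof (rule Bochner_Integration.integrable_bound)
  show "integrable (lebesgue_on S) (\<lambda>x. 2 * (norm (f x))\<^sup>2 + 2 * (norm (g x))\<^sup>2)"
    using assms by (simp add: L2_on_def)
  show "(\<lambda>x. (norm (f x - g x))\<^sup>2) \<in> borel_measurable (lebesgue_on S)"
  proof -
    have [measurable]: "f \<in> borel_measurable (lebesgue_on S)" "g \<in> borel_measurable (lebesgue_on S)"
      using assms by (simp_all add: L2_on_def)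
    show ?thesis by measurable
  qed
  show "AE x in lebesgue_on S. norm ((norm (f x - g x))\<^sup>2) \<le> norm (2 * (norm (f x))\<^sup>2 + 2 * (norm (g x))\<^sup>2)"
  proof (rule AE_I2)
    fix x
    have "(norm (f x - g x))\<^sup>2 \<le> (norm (f x) + norm (g x))\<^sup>2"
      by (intro power_mono norm_triangle_ineq4 norm_ge_zero)
    also have "\<dots> \<le> 2 * (norm (f x))\<^sup>2 + 2 * (norm (g x))\<^sup>2"
      using sum_squares_bound[of "norm (f x)" "norm (g x)"] by (simp add: power2_sum)
    finally show "norm ((norm (f x - g x))\<^sup>2) \<le> norm (2 * (norm (f x))\<^sup>2 + 2 * (norm (g x))\<^sup>2)"
      by simp
  qed
qed

text \<open>The identity holds for test functions and both sides are continuous in the Sobolev norm. For the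
  approximating test functions the deviation of the two sides is the integral of the
  functions \<open>F k\<close> below, whose square is at most \<open>2n\<^sup>2\<close> times the density of the squared Sobolev distance.\<close>

lemma H10_divergence:
  fixes u :: "'a::euclidean_space \<Rightarrow> real"
  assumes "H10 (ball 0 1) u g"
  shows "(LINT x|lebesgue_on (ball 0 1). g x \<bullet> x) = - real DIM('a) * (LINT x|lebesgue_on (ball 0 1). u x)"
proof -
  let ?M = "lebesgue_on (ball (0::'a) 1)" and ?n = "real DIM('a)"
  interpret finite_measure ?M by (rule finite_measure_lebesgue_on_ball)
  have n: "?n \<ge> 1" using DIM_positive[where 'a='a] by linarith
  from assms obtain \<phi> D\<phi> where L2: "L2_on (ball 0 1) u" "L2_on (ball 0 1) g"
    and t: "\<And>k. test_function (ball 0 1) (\<phi> k)" and D: "\<And>k x. GDERIV (\<phi> k) x :> D\<phi> k x"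
    and lim: "(\<lambda>k. LINT x|?M. (\<phi> k x - u x)\<^sup>2 + (norm (D\<phi> k x - g x))\<^sup>2) \<longlonglongrightarrow> 0"
    unfolding H10_def H1_def by blast
  note c = test_function_continuous[OF t] test_function_gradient_continuous[OF t D]
  note L2\<phi> = L2_on_ball_continuous[OF c(1)] L2_on_ball_continuous[OF c(2)]
  note meas = L2(1)[unfolded L2_on_def, THEN conjunct1] L2(2)[unfolded L2_on_def, THEN conjunct1]
     lebesgue_on_measurable_continuous[OF c(1)] lebesgue_on_measurable_continuous[OF c(2)]
     lebesgue_on_measurable_continuous[OF continuous_on_id, unfolded id_def]
  define Q where "Q k x = (\<phi> k x - u x)\<^sup>2 + (norm (D\<phi> k x - g x))\<^sup>2" for k x
  define F where "F k x = (D\<phi> k x - g x) \<bullet> x + ?n * (\<phi> k x - u x)" for k x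
  have Q: "integrable ?M (Q k)" for k
    unfolding Q_def
    using L2_on_diff_norm_square_integrable[OF L2\<phi>(1) L2(1)] L2_on_diff_norm_square_integrable[OF L2\<phi>(2) L2(2)]
    by simp
  have Fm: "F k \<in> borel_measurable ?M" for k
    unfolding F_def[abs_def] by (intro borel_measurable_add borel_measurable_inner borel_measurable_diff
      borel_measurable_times borel_measurable_const meas)
  have FQ: "(F k x)\<^sup>2 \<le> (2 * ?n\<^sup>2) * Q k x" if "x \<in> ball 0 1" for k x
  proof -
    let ?a = "norm (D\<phi> k x - g x)" and ?b = "\<bar>\<phi> k x - u x\<bar>"
    have "\<bar>(D\<phi> k x - g x) \<bullet> x\<bar> \<le> ?a * norm x" by (rule Cauchy_Schwarz_ineq2)
    also have "\<dots> \<le> ?a * 1" using that by (intro mult_left_mono) auto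
    also have "\<dots> \<le> ?n * ?a" using mult_right_mono[OF n, of ?a] by simp
    finally have "\<bar>F k x\<bar> \<le> ?n * ?a + ?n * ?b"
      unfolding F_def using abs_triangle_ineq[of "(D\<phi> k x - g x) \<bullet> x" "?n * (\<phi> k x - u x)"]
      by (simp add: abs_mult)
    then have "\<bar>F k x\<bar> \<le> ?n * (?a + ?b)" by (simp add: distrib_left)
    then have "\<bar>F k x\<bar>\<^sup>2 \<le> (?n * (?a + ?b))\<^sup>2" by (rule power_mono) simp
    also have "\<dots> = ?n\<^sup>2 * (?a + ?b)\<^sup>2" by (rule power_mult_distrib)
    also have "\<dots> \<le> ?n\<^sup>2 * (2 * Q k x)"
      unfolding Q_def using sum_squares_bound[of ?a ?b] by (intro mult_left_mono) (auto simp: power2_sum)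
    finally show ?thesis by (simp add: mult_ac)
  qed
  have F2: "integrable ?M (\<lambda>x. (F k x)\<^sup>2)" for k
  proof (rule Bochner_Integration.integrable_bound)
    show "integrable ?M (\<lambda>x. (2 * ?n\<^sup>2) * Q k x)" using Q by simp
    show "(\<lambda>x. (F k x)\<^sup>2) \<in> borel_measurable ?M" using Fm by simp
    show "AE x in ?M. norm ((F k x)\<^sup>2) \<le> norm ((2 * ?n\<^sup>2) * Q k x)"
      using FQ by (intro AE_I2) (auto simp: space_restrict_space intro: order_trans[OF _ abs_ge_self])
  qed
  have "(\<lambda>k. LINT x|?M. (F k x)\<^sup>2) \<longlonglongrightarrow> 0"
  proof (rule tendsto_sandwich[of "\<lambda>_. 0"])
    show "(\<lambda>k. (2 * ?n\<^sup>2) * (LINT x|?M. Q k x)) \<longlonglongrightarrow> 0"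
      using tendsto_mult[OF tendsto_const[of "2 * ?n\<^sup>2"] lim] by (simp add: Q_def)
    show "\<forall>\<^sub>F k in sequentially. (LINT x|?M. (F k x)\<^sup>2) \<le> (2 * ?n\<^sup>2) * (LINT x|?M. Q k x)"
    proof (rule always_eventually, rule allI)
      fix k
      have "(LINT x|?M. (F k x)\<^sup>2) \<le> (LINT x|?M. (2 * ?n\<^sup>2) * Q k x)"
        using F2 Q FQ by (intro integral_mono) (auto simp: space_restrict_space)
      then show "(LINT x|?M. (F k x)\<^sup>2) \<le> (2 * ?n\<^sup>2) * (LINT x|?M. Q k x)" by simp
    qed
  qed auto
  then have F0: "(\<lambda>k. LINT x|?M. F k x) \<longlonglongrightarrow> 0"
    by (rule integral_tendsto_0_if_integral_square_tendsto_0[OF Fm F2])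
  have inner_int: "integrable ?M (\<lambda>x. h x \<bullet> x)" if "L2_on (ball 0 1) h" for h :: "'a \<Rightarrow> 'a"
  proof (rule square_integrable_imp_integrable)
    have hm: "h \<in> borel_measurable ?M" using that by (simp add: L2_on_def)
    show m: "(\<lambda>x. h x \<bullet> x) \<in> borel_measurable ?M"
      by (intro borel_measurable_inner hm meas)
    show "integrable ?M (\<lambda>x. (h x \<bullet> x)\<^sup>2)"
    proof (rule Bochner_Integration.integrable_bound)
      show "integrable ?M (\<lambda>x. (norm (h x))\<^sup>2)" using that by (simp add: L2_on_def)
      show "AE x in ?M. norm ((h x \<bullet> x)\<^sup>2) \<le> norm ((norm (h x))\<^sup>2)"
      proof (rule AE_I2)
        fix x assume "x \<in> space ?M"
        then have "norm x \<le> 1" by (simp add: space_restrict_space)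
        then have "\<bar>h x \<bullet> x\<bar> \<le> norm (h x)"
          using Cauchy_Schwarz_ineq2[of "h x" x] mult_left_mono[of "norm x" 1 "norm (h x)"] by simp
        then have "\<bar>h x \<bullet> x\<bar>\<^sup>2 \<le> (norm (h x))\<^sup>2" by (rule power_mono) simp
        then show "norm ((h x \<bullet> x)\<^sup>2) \<le> norm ((norm (h x))\<^sup>2)" by simp
      qed
    qed (use m in simp)
  qed
  have "(LINT x|?M. F k x) = - ((LINT x|?M. g x \<bullet> x) + ?n * (LINT x|?M. u x))" for k
  proof -
    have "(LINT x|?M. F k x) = (LINT x|?M. D\<phi> k x \<bullet> x) - (LINT x|?M. g x \<bullet> x)
        + ?n * ((LINT x|?M. \<phi> k x) - (LINT x|?M. u x))"
    proof -
      have i1: "integrable ?M (\<lambda>x. D\<phi> k x \<bullet> x)" by (rule inner_int, rule L2\<phi>(2))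
      have i2: "integrable ?M (\<lambda>x. g x \<bullet> x)" by (rule inner_int, rule L2(2))
      have i3: "integrable ?M (\<phi> k)" by (rule integrable_L2_on_ball, rule L2\<phi>(1))
      have i4: "integrable ?M u" by (rule integrable_L2_on_ball, rule L2(1))
      show ?thesis
        unfolding F_def inner_diff_left
        by (simp only: Bochner_Integration.integral_add Bochner_Integration.integral_diff
            Bochner_Integration.integrable_diff integrable_mult_right i1 i2 i3 i4 integral_mult_right_zero)
    qed
    then show ?thesis
      using test_function_divergence[OF t D, of k] by (simp add: algebra_simps)
  qed
  with F0 show ?thesis
    by (simp add: LIMSEQ_const_iff)
qed

text \<open>Testing the equation of \<open>u\<close> with the torsion function turns the right-hand side into
  \<open>\<integral> f w\<close>. The gradient of \<open>w\<close> is \<open>- x / n\<close>, so the left-hand side is \<open>- 1 / n\<close> times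
  \<open>\<integral> g \<cdot> x\<close>, which is \<open>\<integral> u\<close> by the divergence identity.\<close>

lemma integral_weak_Dirichlet_solution:
  fixes u :: "'a::euclidean_space \<Rightarrow> real"
  assumes "weak_Dirichlet_solution (ball 0 1) f u"
  shows "(LINT x|lebesgue_on (ball 0 1). u x) = (LINT x|lebesgue_on (ball 0 1). f x * torsion x)"
proof -
  let ?M = "lebesgue_on (ball (0::'a) 1)" and ?n = "real DIM('a)"
  obtain g where g: "H10 (ball 0 1) u g"
    and sol: "\<And>v h. H10 (ball 0 1) v h \<Longrightarrow> (LINT x|?M. g x \<bullet> h x) = (LINT x|?M. f x * v x)"
    using assms unfolding weak_Dirichlet_solution_def by blast
  have "(LINT x|?M. f x * torsion x) = (LINT x|?M. g x \<bullet> grad_torsion x)"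
    using sol[OF H10_torsion] by simp
  also have "\<dots> = (LINT x|?M. - (1 / ?n) * (g x \<bullet> x))"
    by (simp add: grad_torsion_def)
  also have "\<dots> = - (1 / ?n) * (LINT x|?M. g x \<bullet> x)"
    by (rule integral_mult_right_zero)
  also have "\<dots> = (LINT x|?M. u x)"
    by (simp add: H10_divergence[OF g])
  finally show ?thesis by simp
qed

section \<open>Rearrangement\<close>

text \<open>The bathtub principle. Replacing \<open>w\<close> by \<open>w - c\<close> changes both integrals by the same amount, because the
  sets have equal measure, and afterwards the integrands are ordered pointwise.\<close>

lemma integral_indicator_mono_level:
  fixes w :: "'b \<Rightarrow> real"
  assumes XY: "X \<in> sets M" "Y \<in> sets M" "emeasure M X < \<infinity>" "emeasure M Y < \<infinity>"
    and eq: "measure M X = measure M Y"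
    and int: "integrable M (\<lambda>x. indicator X x * w x)" "integrable M (\<lambda>x. indicator Y x * w x)"
    and ge: "\<And>x. x \<in> Y - X \<Longrightarrow> w x \<ge> c" and le: "\<And>x. x \<in> X - Y \<Longrightarrow> w x \<le> c"
  shows "(LINT x|M. indicator X x * w x) \<le> (LINT x|M. indicator Y x * w x)"
proof -
  have i: "integrable M (indicator X :: 'b \<Rightarrow> real)" "integrable M (indicator Y :: 'b \<Rightarrow> real)"
    using XY by (simp_all add: integrable_indicator_iff)
  have "(LINT x|M. indicator X x * w x - c * indicator X x) \<le> (LINT x|M. indicator Y x * w x - c * indicator Y x)"
    using ge le by (intro integral_mono Bochner_Integration.integrable_diff integrable_mult_right int i)
      (auto simp: indicator_def)
  moreover have "X \<inter> space M = X" "Y \<inter> space M = Y"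
    using XY(1,2)[THEN sets.sets_into_space] by auto
  ultimately show ?thesis
    using int i eq by simp
qed

lemma integrable_indicator_torsion:
  fixes Z :: "'a::euclidean_space set"
  assumes "Z \<in> sets lebesgue" "Z \<subseteq> ball 0 1"
  shows "integrable (lebesgue_on (ball 0 1)) (\<lambda>x. indicator Z x * torsion x)"
proof -
  let ?M = "lebesgue_on (ball (0::'a) 1)"
  have "integrable ?M torsion"
    by (intro integrable_L2_on_ball L2_on_ball_continuous continuous_torsion)
  moreover have "Z \<in> sets ?M" using assms by (simp add: sets_restrict_space_iff)
  ultimately have "integrable ?M (\<lambda>x. torsion x * indicator Z x)"
    by (intro integrable_real_mult_indicator)
  then show ?thesis by (simp add: mult.commute)
qed

text \<open>The torsion function decreases with the distance from the origin, so the bathtub principle applies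
  with its value on the sphere of radius \<open>s\<close> as the level.\<close>

lemma integral_torsion_mono:
  fixes X Y :: "'a::euclidean_space set"
  assumes X: "X \<in> sets lebesgue" "X \<subseteq> ball 0 1" and Y: "Y \<in> sets lebesgue" "Y \<subseteq> ball 0 1"
    and eq: "measure lebesgue X = measure lebesgue Y" and "s \<ge> 0"
    and ge: "\<And>x. x \<in> Y - X \<Longrightarrow> norm x \<le> s" and le: "\<And>x. x \<in> X - Y \<Longrightarrow> s \<le> norm x"
  shows "(LINT x|lebesgue_on (ball 0 1). indicator X x * torsion x)
    \<le> (LINT x|lebesgue_on (ball 0 1). indicator Y x * torsion x)"
proof -
  let ?M = "lebesgue_on (ball (0::'a) 1)"
  interpret finite_measure ?M by (rule finite_measure_lebesgue_on_ball)
  have XY: "X \<in> sets ?M" "Y \<in> sets ?M"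
    using X Y by (auto simp: sets_restrict_space_iff)
  note int = integrable_indicator_torsion[OF X] integrable_indicator_torsion[OF Y]
  define c where "c = (1 - s\<^sup>2) / (2 * real DIM('a))"
  have c: "c \<le> torsion x \<longleftrightarrow> norm x \<le> s" "torsion x \<le> c \<longleftrightarrow> s \<le> norm x" for x :: 'a
    using \<open>s \<ge> 0\<close> by (simp_all add: c_def torsion_def divide_le_cancel dot_square_norm abs_le_square_iff[symmetric])
  have eq': "measure ?M X = measure ?M Y"
    using X Y eq by (simp add: measure_restrict_space)
  show ?thesis
    by (rule integral_indicator_mono_level[of _ _ _ _ c, OF XY _ _ eq' int])
      (use ge le in \<open>auto simp: c emeasure_eq_measure\<close>)
qed

lemma integral_indicator_Un_torsion:
  fixes X Y :: "'a::euclidean_space set"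
  assumes "X \<in> sets lebesgue" "Y \<in> sets lebesgue" "X \<inter> Y = {}" "X \<subseteq> ball 0 1" "Y \<subseteq> ball 0 1"
  shows "(LINT x|lebesgue_on (ball 0 1). indicator (X \<union> Y) x * torsion x)
    = (LINT x|lebesgue_on (ball 0 1). indicator X x * torsion x)
    + (LINT x|lebesgue_on (ball 0 1). indicator Y x * torsion x)"
proof -
  let ?M = "lebesgue_on (ball (0::'a) 1)"
  have "indicator (X \<union> Y) x * torsion x = indicator X x * torsion x + indicator Y x * torsion x" for x
    using assms(3) by (auto simp: indicator_def)
  then show ?thesis
    using integrable_indicator_torsion[OF assms(1,4)] integrable_indicator_torsion[OF assms(2,5)] by (simp only: Bochner_Integration.integral_add)
qed

lemma measure_lebesgue_ball_scale:
  assumes "0 \<le> s"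
  shows "measure lebesgue (ball (0::'a::euclidean_space) s) = measure lebesgue (ball (0::'a) 1) * s ^ DIM('a)"
  using assms by (simp add: content_ball)

text \<open>The two differences are the complements of the same intersection in sets of equal measure, so each
  carries half of the symmetric difference.\<close>

lemma measure_half_sym_diff:
  assumes E: "E \<in> lmeasurable" and B: "B \<in> lmeasurable" and eq: "measure lebesgue E = measure lebesgue B"
  shows "measure lebesgue (E - B) = measure lebesgue (sym_diff E B) / 2"
    and "measure lebesgue (E \<inter> B) = measure lebesgue B - measure lebesgue (sym_diff E B) / 2"
proof -
  have i: "E \<inter> B \<in> lmeasurable" "E - B \<in> lmeasurable" "B - E \<in> lmeasurable"
    using E B by (auto intro: fmeasurable.Diff fmeasurable.Int)
  have "measure lebesgue ((E \<inter> B) \<union> (E - B)) = measure lebesgue (E \<inter> B) + measure lebesgue (E - B)"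
    using i by (intro measure_Un_AE) auto
  moreover have "measure lebesgue ((E \<inter> B) \<union> (B - E)) = measure lebesgue (E \<inter> B) + measure lebesgue (B - E)"
    using i by (intro measure_Un_AE) auto
  moreover have "measure lebesgue (sym_diff E B) = measure lebesgue (E - B) + measure lebesgue (B - E)"
    using i by (intro measure_Un_AE) auto
  moreover have "(E \<inter> B) \<union> (E - B) = E" "(E \<inter> B) \<union> (B - E) = B" by auto
  ultimately show "measure lebesgue (E - B) = measure lebesgue (sym_diff E B) / 2"
    and "measure lebesgue (E \<inter> B) = measure lebesgue B - measure lebesgue (sym_diff E B) / 2"
    using eq by auto
qed

text \<open>The set \<open>E\<close> is split by the ball \<open>B\<close> of radius \<open>r\<close>. The inner part \<open>E \<inter> B\<close> has the measure of the
  inner ball of \<^const>\<open>A_set\<close>, and \<open>E - B\<close> that of its annulus; among sets of the given measure,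
  the ball carries the largest integral of the torsion function, and among those outside \<open>B\<close>
  the annulus does.\<close>

lemma integral_torsion_le_A_set:
  fixes E :: "'a::euclidean_space set"
  assumes "0 < m" and "m < measure lebesgue (ball (0 :: 'a) 1)"
    and "0 < \<delta>" and "\<delta> < min (2 * m) (2 * (measure lebesgue (ball (0 :: 'a) 1) - m))"
    and mr: "measure lebesgue (ball (0 :: 'a) r) = m"
    and E: "E \<in> sets lebesgue" "E \<subseteq> ball 0 1"
    and mE: "measure lebesgue E = m"
    and \<delta>: "measure lebesgue (sym_diff E (ball 0 r)) = \<delta>"
  shows "(LINT x|lebesgue_on (ball (0::'a) 1). indicator E x * torsion x)
    \<le> (LINT x|lebesgue_on (ball (0::'a) 1). indicator (A_set m r \<delta>) x * torsion x)"
proof -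
  let ?n = "DIM('a)" and ?I = "\<lambda>X. LINT x|lebesgue_on (ball (0::'a) 1). indicator X x * torsion x"
  define V where "V = measure lebesgue (ball (0::'a) 1)"
  define r1 where "r1 = inner_radius TYPE('a) m \<delta>"
  define r2 where "r2 = outer_radius TYPE('a) m \<delta>"
  have V: "V > 0" using assms by (simp add: V_def)
  have vol: "measure lebesgue (ball (0::'a) s) = V * s ^ ?n" if "s \<ge> 0" for s
    using measure_lebesgue_ball_scale[OF that, where 'a='a] by (simp add: V_def)
  have rad: "V * (v powr (1 / ?n) / V powr (1 / ?n)) ^ ?n = v" if "v > 0" for v
  proof -
    have "(y powr (1 / ?n)) ^ ?n = y" if "y > 0" for y :: real
      using that by (simp add: powr_power)
    then show ?thesis using that V by (simp add: power_divide)
  qed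
  have r1: "0 \<le> r1" "V * r1 ^ ?n = m - \<delta> / 2" and r2: "0 \<le> r2" "V * r2 ^ ?n = m + \<delta> / 2"
    using assms rad by (simp_all add: r1_def r2_def inner_radius_def outer_radius_def V_def[symmetric])
  have r: "r > 0" 
  proof (rule ccontr)
    assume "\<not> r > 0"
    then have "ball (0::'a) r = {}" by simp
    then have "measure lebesgue (ball (0::'a) r) = 0" by (simp only: measure_empty)
    then show False using mr assms(1) by linarith
  qed
  have mr': "V * r ^ ?n = m" using vol[of r] r mr by simp
  have "V * r1 ^ ?n < V * r ^ ?n" "V * r ^ ?n < V * r2 ^ ?n" "V * r2 ^ ?n < V * 1 ^ ?n"
    unfolding r1 r2 mr' using assms by (auto simp: V_def)
  then have "r1 ^ ?n < r ^ ?n" "r ^ ?n < r2 ^ ?n" "r2 ^ ?n < 1 ^ ?n"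
    using V by simp_all
  then have lt: "r1 < r" "r < r2" "r2 < 1"
    using r r2(1) by (auto intro: power_less_imp_less_base[of _ ?n])
  define B where "B = ball (0::'a) r"
  define A1 where "A1 = ball (0::'a) r1"
  define A2 where "A2 = {x::'a. r < norm x \<and> norm x < r2}"
  define A2' where "A2' = {x::'a. r \<le> norm x \<and> norm x < r2}"
  have A2_eq: "A2 = ball 0 r2 - cball 0 r" "A2' = ball 0 r2 - ball 0 r"
    by (auto simp: A2_def A2'_def)
  have meas: "A1 \<in> sets lebesgue" "A2 \<in> sets lebesgue" "A2' \<in> sets lebesgue" "B \<in> sets lebesgue"
    unfolding A2_eq by (auto simp: A1_def B_def)
  have sub: "A1 \<subseteq> ball 0 1" "A2 \<subseteq> ball 0 1" "A2' \<subseteq> ball 0 1"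
    using lt by (auto simp: A1_def A2_def A2'_def)
  have mA: "measure lebesgue A1 = m - \<delta> / 2" "measure lebesgue A2 = \<delta> / 2" "measure lebesgue A2' = \<delta> / 2"
  proof -
    show "measure lebesgue A1 = m - \<delta> / 2"
      unfolding A1_def using vol[OF r1(1)] r1(2) by simp
    have "measure lebesgue (cball (0::'a) r) = m"
      using mr by (simp add: content_cball_conv_ball)
    then show "measure lebesgue A2 = \<delta> / 2"
      unfolding A2_eq using vol[OF r2(1)] r2(2) lt
      by (subst measurable_measure_Diff) auto
    show "measure lebesgue A2' = \<delta> / 2"
      unfolding A2_eq using vol[OF r2(1)] r2(2) lt mr
      by (subst measurable_measure_Diff) auto
  qed
  have "E \<in> lmeasurable" "B \<in> lmeasurable"
    using E by (auto intro: fmeasurableI2[of "ball 0 1"] simp: B_def)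
  note half = measure_half_sym_diff[OF this, unfolded mE \<delta>[folded B_def] mr[folded B_def], OF refl]
  have mEB: "measure lebesgue (E - B) = \<delta> / 2" "measure lebesgue (E \<inter> B) = m - \<delta> / 2"
    by (fact half)+
  have "?I E = ?I ((E \<inter> B) \<union> (E - B))"
    by (simp add: Int_Diff_Un)
  also have "\<dots> = ?I (E \<inter> B) + ?I (E - B)"
    using E meas by (intro integral_indicator_Un_torsion) auto
  also have "\<dots> \<le> ?I A1 + ?I A2"
  proof (rule add_mono)
    show "?I (E \<inter> B) \<le> ?I A1"
      by (rule integral_torsion_mono[where s=r1])
        (use E meas sub mA mEB r1 in \<open>auto simp: A1_def\<close>)
    \<comment> \<open>Points of \<open>E\<close> on the sphere of radius \<open>r\<close> lie outside the open annulus although the torsion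
      function is larger there. The half-closed annulus \<open>A2'\<close> includes them and has the same measure.\<close>
    have "?I (E - B) \<le> ?I A2'"
      by (rule integral_torsion_mono[where s=r2])
        (use E meas sub mA mEB r2 in \<open>auto simp: A2'_def B_def\<close>)
    also have "\<dots> \<le> ?I A2"
      by (rule integral_torsion_mono[where s=r])
        (use meas sub mA r in \<open>auto simp: A2'_def A2_def\<close>)
    finally show "?I (E - B) \<le> ?I A2" .
  qed
  also have "\<dots> = ?I (A1 \<union> A2)"
    using meas sub lt by (intro integral_indicator_Un_torsion[symmetric]) (auto simp: A1_def A2_def)
  also have "A1 \<union> A2 = A_set m r \<delta>"
    by (simp add: A_set_def A1_def A2_def r1_def r2_def)
  finally show ?thesis .
qed

theorem proposition2p7:
  fixes m \<delta> r :: real and E :: "(real ^ 'n) set" and u\<^sub>E u\<^sub>A :: "real ^ 'n \<Rightarrow> real"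
  assumes "0 < m" and "m < measure lebesgue (ball (0 :: real ^ 'n) 1)"
    and "0 < \<delta>" and "\<delta> < min (2 * m) (2 * (measure lebesgue (ball (0 :: real ^ 'n) 1) - m))"
    and "measure lebesgue (ball (0 :: real ^ 'n) r) = m"
    and "E \<in> sets lebesgue" and "E \<subseteq> ball 0 1"
    and "measure lebesgue E = m"
    and "measure lebesgue (sym_diff E (ball 0 r)) = \<delta>"
    and "weak_Dirichlet_solution (ball 0 1) (indicator E) u\<^sub>E"
    and "weak_Dirichlet_solution (ball 0 1) (indicator (A_set m r \<delta>)) u\<^sub>A"
  shows "(LINT x|lebesgue_on (ball 0 1). u\<^sub>E x) \<le> (LINT x|lebesgue_on (ball 0 1). u\<^sub>A x)"
  unfolding integral_weak_Dirichlet_solution[OF assms(10)] integral_weak_Dirichlet_solution[OF assms(11)]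
  by (rule integral_torsion_le_A_set[OF assms(1-9)])

end
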